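(* Let $P$ be a logic program (as described in the context) such that (i) every rule of $P$ has a non-empty body, and (ii) $P$ has no left recursion: for every rule $A \leftarrow B_1 \wedge \dots \wedge B_n$ of $P$, with $p$ the predicate of $A$ and $q$ the predicate of $B_1$, we have $q \neq p$ and $q$ does not depend (directly or indirectly) on $p$. Then for every finite set $G$ of goals, the set $\mathrm{cl}_P(G)$ is finite.
   Context: Terms are variables or constants (no function symbols). A literal is $p(t_1,\dots,t_m)$ with a predicate $p$ and terms $t_j$. A logic program $P$ is a finite set of rules $A \leftarrow B_1 \wedge \dots \wedge B_n$ ($n \ge 0$), with $A, B_i$ literals, and every variable of $A$ occurring in some $B_i$. Predicates occurring in rule heads are IDB predicates. The remaining predicates (EDB predicates, and a special predicate $\mathit{answer}$) never occur in rule heads, and $\mathit{answer}$ does not occur in $P$ at all. A predicate $p$ depends directly on $q$ if $q$ occurs in the body of a rule whose head has predicate $p$. "Depends" is the transitive closure of this relation. A goal is a finite conjunction $L_1 \wedge \dots \wedge L_k$ of literals. An SLD-resolution step with a rule of $P$, using the leftmost selection rule, proceeds as follows. Take a variant $A \leftarrow B_1 \wedge \dots \wedge B_n$ of a rule of $P$ whose variables are disjoint from those of the goal, such that $L_1$ and $A$ have a most general unifier $\theta$. The step transforms $L_1 \wedge \dots \wedge L_k$ into $(B_1 \wedge \dots \wedge B_n \wedge L_2 \wedge \dots \wedge L_k)\theta$. An SLD-derivation using only rules in $P$ is a finite (possibly empty) sequence of such steps. Fix variables $V_1, V_2, \dots$. The map $\mathrm{norm}(g)$ renames the variables of a goal $g$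 so that they are $V_1, V_2, \dots$ in the order of their first occurrence in $g$. For a set $G$ of goals, $\mathrm{cl}_P(G) = \{\mathrm{norm}(g') : \text{there is } g \in G \text{ and an SLD-derivation } g \to^* g' \text{ using only rules in } P\}$. *)

theory Defs
  imports Main
begin

datatype ('c, 'v) trm = Var 'v | Const 'c

datatype ('p, 'c, 'v) lit = Lit (pred: 'p) (args: "('c, 'v) trm list")

datatype ('p, 'c, 'v) rule = Rule (head: "('p, 'c, 'v) lit") (body: "('p, 'c, 'v) lit list")

text \<open>Conjunctions are ordered, since the selection rule is leftmost; the list may be empty.\<close>

type_synonym ('p, 'c, 'v) goal = "('p, 'c, 'v) lit list"

fun trm_vars :: "('c, 'v) trm \<Rightarrow> 'v list" where
  "trm_vars (Var x) = [x]"
| "trm_vars (Const c) = []"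

definition lit_vars :: "('p, 'c, 'v) lit \<Rightarrow> 'v list" where
  "lit_vars L = concat (map trm_vars (args L))"

definition goal_vars :: "('p, 'c, 'v) goal \<Rightarrow> 'v list" where
  "goal_vars g = concat (map lit_vars g)"

definition rule_vars :: "('p, 'c, 'v) rule \<Rightarrow> 'v set" where
  "rule_vars r = set (lit_vars (head r)) \<union> set (goal_vars (body r))"

definition rule_preds :: "('p, 'c, 'v) rule \<Rightarrow> 'p set" where
  "rule_preds r = insert (pred (head r)) (pred ` set (body r))"


definition logic_program :: "'p \<Rightarrow> ('p, 'c, 'v) rule set \<Rightarrow> bool" where
  "logic_program answer P \<longleftrightarrow>
     finite P \<and>
     (\<forall>r\<in>P. set (lit_vars (head r)) \<subseteq> set (goal_vars (body r))) \<and>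
     (\<forall>r\<in>P. answer \<notin> rule_preds r)"

definition depends_directly :: "('p, 'c, 'v) rule set \<Rightarrow> 'p \<Rightarrow> 'p \<Rightarrow> bool" where
  "depends_directly P p q \<longleftrightarrow> (\<exists>r\<in>P. pred (head r) = p \<and> q \<in> pred ` set (body r))"

definition depends :: "('p, 'c, 'v) rule set \<Rightarrow> 'p \<Rightarrow> 'p \<Rightarrow> bool" where
  "depends P = (depends_directly P)\<^sup>+\<^sup>+"

definition no_left_recursion :: "('p, 'c, 'v) rule set \<Rightarrow> bool" where
  "no_left_recursion P \<longleftrightarrow>
     (\<forall>r\<in>P. \<forall>B Bs. body r = B # Bs \<longrightarrow>
        pred B \<noteq> pred (head r) \<and> \<not> depends P (pred B) (pred (head r)))"


fun subst_trm :: "('v \<Rightarrow> ('c, 'v) trm) \<Rightarrow> ('c, 'v) trm \<Rightarrow> ('c, 'v) trm" where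
  "subst_trm \<sigma> (Var x) = \<sigma> x"
| "subst_trm \<sigma> (Const c) = Const c"

definition subst_lit :: "('v \<Rightarrow> ('c, 'v) trm) \<Rightarrow> ('p, 'c, 'v) lit \<Rightarrow> ('p, 'c, 'v) lit" where
  "subst_lit \<sigma> L = Lit (pred L) (map (subst_trm \<sigma>) (args L))"

definition subst_goal :: "('v \<Rightarrow> ('c, 'v) trm) \<Rightarrow> ('p, 'c, 'v) goal \<Rightarrow> ('p, 'c, 'v) goal" where
  "subst_goal \<sigma> g = map (subst_lit \<sigma>) g"

definition subst_rule :: "('v \<Rightarrow> ('c, 'v) trm) \<Rightarrow> ('p, 'c, 'v) rule \<Rightarrow> ('p, 'c, 'v) rule" where
  "subst_rule \<sigma> r = Rule (subst_lit \<sigma> (head r)) (subst_goal \<sigma> (body r))"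

text \<open>As usual in logic programming, a substitution moves only finitely many variables.\<close>

definition is_subst :: "('v \<Rightarrow> ('c, 'v) trm) \<Rightarrow> bool" where
  "is_subst \<sigma> \<longleftrightarrow> finite {x. \<sigma> x \<noteq> Var x}"

definition is_unifier ::
  "('v \<Rightarrow> ('c, 'v) trm) \<Rightarrow> ('p, 'c, 'v) lit \<Rightarrow> ('p, 'c, 'v) lit \<Rightarrow> bool" where
  "is_unifier \<sigma> L M \<longleftrightarrow> is_subst \<sigma> \<and> subst_lit \<sigma> L = subst_lit \<sigma> M"

text \<open>Any most general unifier is allowed: idempotence is not required.\<close>

definition is_mgu ::
  "('v \<Rightarrow> ('c, 'v) trm) \<Rightarrow> ('p, 'c, 'v) lit \<Rightarrow> ('p, 'c, 'v) lit \<Rightarrow> bool" where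
  "is_mgu \<theta> L M \<longleftrightarrow>
     is_unifier \<theta> L M \<and>
     (\<forall>\<sigma>. is_unifier \<sigma> L M \<longrightarrow>
        (\<exists>\<gamma>. is_subst \<gamma> \<and> (\<forall>x. \<sigma> x = subst_trm \<gamma> (\<theta> x))))"

definition is_variant :: "('p, 'c, 'v) rule \<Rightarrow> ('p, 'c, 'v) rule \<Rightarrow> bool" where
  "is_variant r' r \<longleftrightarrow>
     (\<exists>\<rho>. inj_on \<rho> (rule_vars r) \<and> r' = subst_rule (\<lambda>x. Var (\<rho> x)) r)"

inductive sld_step ::
  "('p, 'c, 'v) rule set \<Rightarrow> ('p, 'c, 'v) goal \<Rightarrow> ('p, 'c, 'v) goal \<Rightarrow> bool"
  for P :: "('p, 'c, 'v) rule set" where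
  "\<lbrakk> r \<in> P; is_variant r' r; rule_vars r' \<inter> set (goal_vars (L # Ls)) = {};
     is_mgu \<theta> L (head r') \<rbrakk>
   \<Longrightarrow> sld_step P (L # Ls) (subst_goal \<theta> (body r' @ Ls))"


text \<open>
  A variable \<open>x\<close> of \<open>g\<close> with \<open>k\<close> distinct variables occurring before its first occurrence is
  the \<open>(k + 1)\<close>-st variable in the order of first occurrence, and becomes \<open>V (k + 1)\<close>; the
  enumeration \<open>V\<close> of the fixed variables starts at index \<open>1\<close>, and \<open>V 0\<close> is never used.
\<close>

definition norm :: "(nat \<Rightarrow> 'v) \<Rightarrow> ('p, 'c, 'v) goal \<Rightarrow> ('p, 'c, 'v) goal" where
  "norm V g =
     subst_goal (\<lambda>x. Var (V (card (set (takeWhile (\<lambda>y. y \<noteq> x) (goal_vars g))) + 1))) g"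

definition cl ::
  "(nat \<Rightarrow> 'v) \<Rightarrow> ('p, 'c, 'v) rule set \<Rightarrow> ('p, 'c, 'v) goal set \<Rightarrow> ('p, 'c, 'v) goal set" where
  "cl V P G = {norm V g' | g g'. g \<in> G \<and> (sld_step P)\<^sup>*\<^sup>* g g'}"

end

(* Bodies are non-empty, so a step never removes the leftmost position: the new leftmost literal
   is the first body literal of the rule used, and the literals to its right are never selected.
   Without left recursion the leftmost predicate descends strictly in the dependency order, hence
   derivations have bounded length and goals have bounded size. A most general unifier introduces
   no constants, so only finitely many goals remain once the variables are normalized. *)

theory Submission
  imports Defs
begin

text \<open>With every variable and finitely many constants in \<open>T\<close>, membership of all
  literals is an invariant of derivations; with \<open>T\<close> finite the set is finite. Argument
  lists are bounded in length because predicates carry no fixed arity.\<close>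

definition lits_over ::
  "'p set \<Rightarrow> nat \<Rightarrow> ('c, 'v) trm set \<Rightarrow> ('p, 'c, 'v) lit set" where
  "lits_over Q m T = {L. pred L \<in> Q \<and> length (args L) \<le> m \<and> set (args L) \<subseteq> T}"

lemma finite_lits_over:
  assumes "finite Q" "finite T"
  shows "finite (lits_over Q m T)"
proof (rule finite_subset)
  show "lits_over Q m T \<subseteq> (\<lambda>(p, ts). Lit p ts) ` (Q \<times> {ts. set ts \<subseteq> T \<and> length ts \<le> m})"
  proof
    fix L assume "L \<in> lits_over Q m T"
    then show "L \<in> (\<lambda>(p, ts). Lit p ts) ` (Q \<times> {ts. set ts \<subseteq> T \<and> length ts \<le> m})"
      by (cases L) (auto simp: lits_over_def)
  qed
  show "finite ((\<lambda>(p, ts). Lit p ts) ` (Q \<times> {ts. set ts \<subseteq> T \<and> length ts \<le> m}))"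
    using assms finite_lists_length_le[of T m] by blast
qed

lemma finite_subset_lits_over:
  fixes F :: "('p, 'c, 'v) lit set"
  assumes "finite F"
  obtains Q m C where "finite Q" "finite C" "F \<subseteq> lits_over Q m (range Var \<union> Const ` C)"
proof
  let ?C = "\<Union>L\<in>F. Const -` set (args L)"
  let ?m = "Max ((\<lambda>L. length (args L)) ` F)"
  show "finite (pred ` F)" using assms by simp
  show "finite ?C" using assms by (auto intro!: finite_vimageI injI)
  show "F \<subseteq> lits_over (pred ` F) ?m (range Var \<union> Const ` ?C)"
  proof
    fix L assume L: "L \<in> F"
    have "t \<in> range Var \<union> Const ` ?C" if "t \<in> set (args L)" for t
    proof (cases t)
      case (Const c)
      then show ?thesis using that L by auto
    qed auto
    then show "L \<in> lits_over (pred ` F) ?m (range Var \<union> Const ` ?C)"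
      using L assms by (auto simp: lits_over_def)
  qed
qed

text \<open>Serves renamings and unifiers, where \<open>T\<close> is again all variables plus
  \<open>C\<close>, and also \<open>norm\<close>, where \<open>T\<close> is finite.\<close>

lemma subst_lit_in_lits_over:
  assumes "L \<in> lits_over Q m (range Var \<union> Const ` C)"
    and "range \<sigma> \<subseteq> T" "Const ` C \<subseteq> T"
  shows "subst_lit \<sigma> L \<in> lits_over Q m T"
proof -
  have "subst_trm \<sigma> t \<in> T" if "t \<in> set (args L)" for t
  proof -
    have "t \<in> range Var \<union> Const ` C" using that assms(1) by (auto simp: lits_over_def)
    then show ?thesis using assms(2,3) by auto
  qed
  then show ?thesis using assms by (auto simp: lits_over_def subst_lit_def)
qed

lemma mgu_no_new_const:
  fixes \<theta> :: "'v \<Rightarrow> ('c, 'v) trm"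
  assumes mgu: "is_mgu \<theta> L M" and x: "\<theta> x = Const c"
  shows "Const c \<in> set (args L) \<union> set (args M)"
proof (rule ccontr)
  assume new: "Const c \<notin> set (args L) \<union> set (args M)"
  \<comment> \<open>If \<open>c\<close> were new, replacing it by a variable would give a more general unifier.\<close>
  define h where "h t = (if t = Const c then Var x else t)" for t :: "('c, 'v) trm"
  define \<sigma> where "\<sigma> y = h (\<theta> y)" for y
  have trm: "subst_trm \<sigma> t = h (subst_trm \<theta> t)" if "t \<noteq> Const c" for t
    using that by (cases t) (auto simp: \<sigma>_def h_def)
  have lit: "subst_lit \<sigma> N = Lit (pred N) (map h (args (subst_lit \<theta> N)))"
    if "Const c \<notin> set (args N)" for N :: "('d, 'c, 'v) lit"
    using that by (auto simp: subst_lit_def intro!: trm)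
  have \<theta>: "is_subst \<theta>" "subst_lit \<theta> L = subst_lit \<theta> M"
    using mgu by (auto simp: is_mgu_def is_unifier_def)
  have "{y. \<sigma> y \<noteq> Var y} \<subseteq> {y. \<theta> y \<noteq> Var y}"
    by (auto simp: \<sigma>_def h_def)
  then have "is_subst \<sigma>"
    using \<theta>(1) by (auto simp: is_subst_def intro: finite_subset)
  moreover have "pred L = pred M"
    using \<theta>(2) by (simp add: subst_lit_def)
  then have "subst_lit \<sigma> L = subst_lit \<sigma> M"
    using lit[of L] lit[of M] new \<theta>(2) by simp
  ultimately obtain \<gamma> where "\<sigma> x = subst_trm \<gamma> (\<theta> x)"
    using mgu by (auto simp: is_mgu_def is_unifier_def)
  \<comment> \<open>\<open>\<sigma> x\<close> is \<open>Var x\<close>, whereas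
    \<open>\<gamma>\<close> leaves the constant \<open>\<theta> x\<close> fixed, so
    \<open>\<sigma>\<close> cannot factor through \<open>\<theta>\<close>.\<close>
  then show False
    using x by (simp add: \<sigma>_def h_def)
qed

text \<open>Renaming a rule changes variables only, and the constants in the range of the unifier
  already occur in the selected literal or the renamed head.\<close>

lemma sld_step_lits_over:
  fixes P :: "('p, 'c, 'v) rule set"
  assumes step: "sld_step P g g'"
    and P: "\<And>r. r \<in> P \<Longrightarrow> insert (head r) (set (body r)) \<subseteq> lits_over Q m (range Var \<union> Const ` C)"
    and g: "set g \<subseteq> lits_over Q m (range Var \<union> Const ` C)"
  shows "set g' \<subseteq> lits_over Q m (range Var \<union> Const ` C)"
  using step
proof cases
  case (1 r r' L Ls \<theta>)
  let ?T = "range Var \<union> Const ` C :: ('c, 'v) trm set"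
  obtain \<rho> where "r' = subst_rule (\<lambda>x. Var (\<rho> x)) r"
    using 1 by (auto simp: is_variant_def)
  then have r': "head r' \<in> lits_over Q m ?T" "set (body r') \<subseteq> lits_over Q m ?T"
    using P[OF \<open>r \<in> P\<close>]
    by (auto simp: subst_rule_def subst_goal_def intro!: subst_lit_in_lits_over)
  have "\<theta> x \<in> ?T" for x
  proof (cases "\<theta> x")
    case (Const c)
    then show ?thesis
      using mgu_no_new_const[OF \<open>is_mgu \<theta> L (head r')\<close> Const] r' g 1 by (auto simp: lits_over_def)
  qed auto
  then have "range \<theta> \<subseteq> ?T" by auto
  then show ?thesis
    using 1 g r' by (auto simp: subst_goal_def intro!: subst_lit_in_lits_over)
qed

text \<open>Recursion away from the leftmost position may make the dependency relation cyclic, so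
  only predicates strictly below \<open>p\<close> are counted, not those in its own cycle.\<close>

definition pred_rank :: "('p, 'c, 'v) rule set \<Rightarrow> 'p \<Rightarrow> nat" where
  "pred_rank P p = card {q. depends P p q \<and> \<not> depends P q p}"

lemma depends_trans: "depends P p q \<Longrightarrow> depends P q s \<Longrightarrow> depends P p s"
  unfolding depends_def by (rule tranclp_trans)

lemma finite_depends:
  assumes "finite P"
  shows "finite {q. depends P p q}"
proof (rule finite_subset)
  have "\<exists>p'. depends_directly P p' q" if "depends P p q" for q
    using that unfolding depends_def by cases auto
  then show "{q. depends P p q} \<subseteq> (\<Union>r\<in>P. pred ` set (body r))"
    unfolding depends_directly_def by blast
  show "finite (\<Union>r\<in>P. pred ` set (body r))" using assms by simp
qed

lemma pred_rank_less:
  assumes "finite P" "depends P p q" "\<not> depends P q p"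
  shows "pred_rank P q < pred_rank P p"
  unfolding pred_rank_def
proof (rule psubset_card_mono)
  show "finite {s. depends P p s \<and> \<not> depends P s p}"
    using finite_depends[OF assms(1), of p] by simp
  \<comment> \<open>The inclusion is proper because \<open>q\<close> lies strictly below
    \<open>p\<close> but never strictly below itself.\<close>
  show "{s. depends P q s \<and> \<not> depends P s q} \<subset> {s. depends P p s \<and> \<not> depends P s p}"
    using assms(2,3) by (blast intro: depends_trans)
qed

text \<open>A bound on the length that survives steps: each unit of rank of the leftmost predicate
  is a reserve of \<open>k\<close> literals. For the empty goal \<open>hd\<close> is unspecified,
  but no step starts there.\<close>

definition goal_size :: "('p, 'c, 'v) rule set \<Rightarrow> nat \<Rightarrow> ('p, 'c, 'v) goal \<Rightarrow> nat" where
  "goal_size P k g = length g + k * pred_rank P (pred (hd g))"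

lemma sld_step_goal_size:
  assumes step: "sld_step P g g'"
    and P: "finite P" "no_left_recursion P" "\<forall>r\<in>P. body r \<noteq> []"
    and k: "\<And>r. r \<in> P \<Longrightarrow> length (body r) \<le> k"
  shows "goal_size P k g' \<le> goal_size P k g"
  using step
proof cases
  case (1 r r' L Ls \<theta>)
  obtain B Bs where B: "body r = B # Bs"
    using P(3) \<open>r \<in> P\<close> by (cases "body r") auto
  obtain \<rho> where r': "r' = subst_rule (\<lambda>x. Var (\<rho> x)) r"
    using 1 by (auto simp: is_variant_def)
  have "subst_lit \<theta> L = subst_lit \<theta> (head r')"
    using 1 by (auto simp: is_mgu_def is_unifier_def)
  then have L: "pred L = pred (head r)"
    by (simp add: r' subst_lit_def subst_rule_def)
  have "depends P (pred (head r)) (pred B)"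
    unfolding depends_def
    by (rule tranclp.r_into_trancl)
      (use \<open>r \<in> P\<close> B in \<open>auto simp: depends_directly_def intro!: bexI[of _ r]\<close>)
  moreover have "\<not> depends P (pred B) (pred (head r))"
    using P(2) \<open>r \<in> P\<close> B by (auto simp: no_left_recursion_def)
  ultimately have "Suc (pred_rank P (pred B)) \<le> pred_rank P (pred L)"
    using pred_rank_less[OF P(1)] L by (simp add: Suc_le_eq)
  \<comment> \<open>The drop in rank from \<open>L\<close> to \<open>B\<close> releases at least
    \<open>k\<close>, which pays for the body literals that replace \<open>L\<close>.\<close>
  then have "k * Suc (pred_rank P (pred B)) \<le> k * pred_rank P (pred L)"
    by (rule mult_le_mono2)
  moreover have "length (body r) \<le> k" using k \<open>r \<in> P\<close> .
  ultimately show ?thesis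
    by (simp add: 1 r' B goal_size_def subst_goal_def subst_rule_def subst_lit_def)
qed

lemma length_lit_vars_le: "length (lit_vars L) \<le> length (args L)"
proof -
  have "length (concat (map trm_vars ts)) \<le> length ts" for ts :: "('c, 'v) trm list"
  proof (induction ts)
    case (Cons t ts)
    then show ?case by (cases t) auto
  qed simp
  then show ?thesis by (simp add: lit_vars_def)
qed

text \<open>Each occurrence of a variable fills an argument position; this limits the indices that
  \<open>norm\<close> can assign.\<close>

lemma length_goal_vars_le:
  assumes "set g \<subseteq> lits_over Q m T"
  shows "length (goal_vars g) \<le> length g * m"
  using assms
proof (induction g)
  case (Cons L g)
  then have "length (lit_vars L) \<le> m"
    using length_lit_vars_le[of L] by (auto simp: lits_over_def)
  with Cons show ?case by (simp add: goal_vars_def)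
qed (simp add: goal_vars_def)

lemma finite_norm_image:
  fixes V :: "nat \<Rightarrow> 'v" and Q :: "'p set" and C :: "'c set"
  assumes "finite Q" "finite C"
  shows "finite (norm V ` {g. set g \<subseteq> lits_over Q m (range Var \<union> Const ` C) \<and> length g \<le> n})"
    (is "finite (norm V ` ?A)")
proof (rule finite_subset)
  \<comment> \<open>At most \<open>n * m\<close> variables precede a first occurrence, and numbering
    starts at 1. For a variable absent from the goal \<open>takeWhile\<close> returns the whole
    list, so the bound covers the full range of the renaming.\<close>
  let ?T = "Var ` V ` {..n * m + 1} \<union> Const ` C :: ('c, 'v) trm set"
  let ?B = "{g :: ('p, 'c, 'v) goal. set g \<subseteq> lits_over Q m ?T \<and> length g \<le> n}"
  have "finite (lits_over Q m ?T)"
    using assms by (simp add: finite_lits_over)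
  then show "finite ?B"
    by (rule finite_lists_length_le)
  show "norm V ` ?A \<subseteq> ?B"
  proof (rule image_subsetI)
    fix g :: "('p, 'c, 'v) goal" assume g: "g \<in> ?A"
    let ?\<sigma> = "\<lambda>x. Var (V (card (set (takeWhile (\<lambda>y. y \<noteq> x) (goal_vars g))) + 1))"
    have "card (set (takeWhile (\<lambda>y. y \<noteq> x) (goal_vars g))) \<le> n * m" for x
    proof -
      have "card (set (takeWhile (\<lambda>y. y \<noteq> x) (goal_vars g))) \<le> length (goal_vars g)"
        by (rule order_trans[OF card_length length_takeWhile_le])
      also have "\<dots> \<le> length g * m"
        using g by (auto intro: length_goal_vars_le)
      also have "\<dots> \<le> n * m"
        using g by simp
      finally show ?thesis .
    qed
    then have "range ?\<sigma> \<subseteq> ?T" by auto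
    then show "norm V g \<in> ?B"
      using g by (auto simp: norm_def subst_goal_def intro!: subst_lit_in_lits_over)
  qed
qed

theorem mainTheorem1:
  fixes V :: "nat \<Rightarrow> 'v"
    and answer :: 'p
    and P :: "('p, 'c, 'v) rule set"
    and G :: "('p, 'c, 'v) goal set"
  assumes "inj_on V {1..}"
    and "logic_program answer P"
    and "\<forall>r\<in>P. body r \<noteq> []"
    and "no_left_recursion P"
    and "finite G"
  shows "finite (cl V P G)"
proof -
  have P: "finite P" using assms(2) by (simp add: logic_program_def)
  let ?F = "(\<Union>g\<in>G. set g) \<union> (\<Union>r\<in>P. insert (head r) (set (body r)))"
  obtain Q m C where fin: "finite Q" "finite C"
    and F: "?F \<subseteq> lits_over Q m (range Var \<union> Const ` C)"
    by (rule finite_subset_lits_over[of ?F]) (use P assms(5) in auto)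
  \<comment> \<open>For empty \<open>P\<close> this value is unspecified, but the bound concerns
    only members of \<open>P\<close>.\<close>
  define k where "k = Max ((\<lambda>r. length (body r)) ` P)"
  have k: "length (body r) \<le> k" if "r \<in> P" for r
    using P that by (simp add: k_def)
  define n where "n = Max (goal_size P k ` G)"
  let ?A = "{g. set g \<subseteq> lits_over Q m (range Var \<union> Const ` C) \<and> length g \<le> n}"
  have "g' \<in> ?A" if "g \<in> G" "(sld_step P)\<^sup>*\<^sup>* g g'" for g g'
  proof -
    \<comment> \<open>The length alone may grow along a derivation, so the induction carries
      \<open>goal_size\<close>, which dominates it.\<close>
    have "set g' \<subseteq> lits_over Q m (range Var \<union> Const ` C) \<and> goal_size P k g' \<le> n"
      using that(2)
    proof (induction rule: rtranclp_induct)
      case base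
      show ?case using that(1) F assms(5) by (auto simp: n_def)
    next
      case (step h h')
      have "set h' \<subseteq> lits_over Q m (range Var \<union> Const ` C)"
        by (rule sld_step_lits_over[OF step.hyps(2)]) (use F step.IH in auto)
      moreover have "goal_size P k h' \<le> goal_size P k h"
        using sld_step_goal_size[OF step.hyps(2) P assms(4,3) k] .
      ultimately show ?case using step.IH by auto
    qed
    then show ?thesis by (simp add: goal_size_def)
  qed
  then have "cl V P G \<subseteq> norm V ` ?A"
    by (auto simp: cl_def)
  then show ?thesis
    using finite_norm_image[OF fin] by (rule finite_subset)
qed

end
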